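(* For every integer $n\ge 2$, $P_b(P_n)=\operatorname{diam}(P_n)=n-1$, and for every integer $n\ge 3$, $P_b(C_n)=\operatorname{diam}(C_n)=\left\lfloor\frac{n}{2}\right\rfloor$, where $P_n$ and $C_n$ are the path and cycle of order $n$.
   Context: For a graph $G=(V,E)$, a broadcast is a function $f:V\to\{0,\dots,\operatorname{diam}(G)\}$ with $f(v)\le e_G(v)$ (eccentricity) for all $v$. Let $V^+_f=\{v: f(v)>0\}$ and $H_f(u)=\{v\in V^+_f: d_G(u,v)\le f(v)\}$. The cost is $\sigma(f)=\sum_v f(v)$. $f$ is a packing broadcast if $|H_f(u)|\le1$ for every $u\in V$. $P_b(G)$ is the maximum cost of a packing broadcast on $G$. *)

theory Defs
  imports "Graph_Theory.Graph_Theory" "HOL-Library.Extended_Nat"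
begin

text \<open>
  An undirected graph is a symmetric digraph, as in the locale \<^locale>\<open>pair_graph\<close>: each edge is
  a pair of opposite arcs. Distance, eccentricity and diameter are extended naturals, so that
  vertices in different components are at distance \<open>\<infinity>\<close>. The distance is the unit-weight
  instance of \<open>\<mu>\<close> from \<^theory>\<open>Graph_Theory.Shortest_Path\<close>, with values in \<^typ>\<open>enat\<close>
  instead of \<open>ereal\<close>.
\<close>

definition gdist :: "('a, 'b) pre_digraph \<Rightarrow> 'a \<Rightarrow> 'a \<Rightarrow> enat" where
  "gdist G u v = (INF p\<in>{p. pre_digraph.awalk G u p v}. enat (length p))"

definition ecc :: "('a, 'b) pre_digraph \<Rightarrow> 'a \<Rightarrow> enat" where
  "ecc G v = (SUP u\<in>verts G. gdist G v u)"

definition diam :: "('a, 'b) pre_digraph \<Rightarrow> enat" where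
  "diam G = (SUP v\<in>verts G. ecc G v)"

text \<open>
  Only the values of a broadcast on \<^term>\<open>verts G\<close> matter; those elsewhere are left arbitrary.
\<close>

definition broadcast :: "('a, 'b) pre_digraph \<Rightarrow> ('a \<Rightarrow> nat) \<Rightarrow> bool" where
  "broadcast G f \<longleftrightarrow> (\<forall>v\<in>verts G. enat (f v) \<le> diam G \<and> enat (f v) \<le> ecc G v)"

definition broadcast_verts :: "('a, 'b) pre_digraph \<Rightarrow> ('a \<Rightarrow> nat) \<Rightarrow> 'a set" where
  "broadcast_verts G f = {v \<in> verts G. f v > 0}"

definition heard :: "('a, 'b) pre_digraph \<Rightarrow> ('a \<Rightarrow> nat) \<Rightarrow> 'a \<Rightarrow> 'a set" where
  "heard G f u = {v \<in> broadcast_verts G f. gdist G u v \<le> enat (f v)}"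

definition cost :: "('a, 'b) pre_digraph \<Rightarrow> ('a \<Rightarrow> nat) \<Rightarrow> nat" where
  "cost G f = (\<Sum>v\<in>verts G. f v)"

definition packing_broadcast :: "('a, 'b) pre_digraph \<Rightarrow> ('a \<Rightarrow> nat) \<Rightarrow> bool" where
  "packing_broadcast G f \<longleftrightarrow> broadcast G f \<and> (\<forall>u\<in>verts G. card (heard G f u) \<le> 1)"

text \<open>
  For a finite connected graph the set of costs is finite and nonempty, so \<^const>\<open>Max\<close> is attained.
\<close>

definition packing_broadcast_number :: "('a, 'b) pre_digraph \<Rightarrow> nat" where
  "packing_broadcast_number G = Max {cost G f | f. packing_broadcast G f}"

definition path_graph :: "nat \<Rightarrow> nat pair_pre_digraph" where
  "path_graph n = \<lparr> pverts = {0..<n},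
     parcs = {(i, j). i < n \<and> j < n \<and> (j = Suc i \<or> i = Suc j)} \<rparr>"

definition cycle_graph :: "nat \<Rightarrow> nat pair_pre_digraph" where
  "cycle_graph n = \<lparr> pverts = {0..<n},
     parcs = {(i, j). i < n \<and> j < n \<and> (j = Suc i mod n \<or> i = Suc j mod n)} \<rparr>"

lemma pair_graph_path_graph: "pair_graph (path_graph n)"
proof
  show "finite (parcs (path_graph n))"
    by (rule finite_subset[of _ "{0..<n} \<times> {0..<n}"]) (auto simp: path_graph_def)
  show "symmetric (with_proj (path_graph n))"
    by (auto simp: symmetric_def path_graph_def intro!: symI)
qed (auto simp: path_graph_def)

lemma pair_graph_cycle_graph:
  assumes "n \<ge> 2"
  shows "pair_graph (cycle_graph n)"
proof
  show "finite (parcs (cycle_graph n))"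
    by (rule finite_subset[of _ "{0..<n} \<times> {0..<n}"]) (auto simp: cycle_graph_def)
  show "symmetric (with_proj (cycle_graph n))"
    by (auto simp: symmetric_def cycle_graph_def intro!: symI)
qed (use assms in \<open>auto simp: cycle_graph_def mod_Suc split: if_splits\<close>)

end

theory Submission
  imports Defs
begin

text \<open>
  In a packing broadcast the balls \<open>B(v, f v)\<close> around the broadcasting vertices are pairwise
  disjoint. In a path such a ball has at least \<open>f v + 1\<close> vertices because \<open>f v\<close> is at most the
  eccentricity of \<open>v\<close>; in a cycle it has at least \<open>2 * f v\<close> vertices because \<open>f v \<le> n div 2\<close>.
  Counting vertices bounds the cost by the diameter, and a single vertex of maximal eccentricity
  broadcasting at full strength attains it.
\<close>

section \<open>Distances\<close>

text \<open>Consecutive arcs along the chain concatenate to a walk of length \<open>k\<close>. Upper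
  bounds thus need only a vertex sequence given by a formula; repeated vertices are
  harmless.\<close>

lemma gdist_le_of_chain:
  assumes "wf_digraph G" "c 0 \<in> verts G" "\<And>i. i < k \<Longrightarrow> (c i, c (Suc i)) \<in> arcs_ends G"
  shows "gdist G (c 0) (c k) \<le> enat k"
proof -
  interpret wf_digraph G by fact
  have "\<exists>p. awalk (c 0) p (c k) \<and> length p = k"
    using assms(3)
  proof (induction k)
    case 0
    then show ?case
      using assms(2) by (auto intro!: exI[of _ "[]"] simp: awalk_Nil_iff)
  next
    case (Suc k)
    then obtain p where p: "awalk (c 0) p (c k)" "length p = k"
      by auto
    obtain e where e: "e \<in> arcs G" "tail G e = c k" "head G e = c (Suc k)"
      using Suc.prems[of k] by (auto simp: arcs_ends_def arc_to_ends_def)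
    have "awalk (c k) [e] (c (Suc k))"
      using e arc_implies_awalk[of e] by simp
    then have "awalk (c 0) (p @ [e]) (c (Suc k))"
      using p by (meson awalk_appendI)
    then show ?case
      using p(2) by (intro exI[of _ "p @ [e]"]) simp
  qed
  then obtain p where "awalk (c 0) p (c k)" "length p = k"
    by blast
  then show ?thesis
    unfolding gdist_def by (auto intro!: INF_lower2[of p])
qed

text \<open>By induction along a walk, \<open>h\<close> grows by at most the length of the walk. A
  suitable potential \<open>h\<close> thus certifies a lower bound without inspecting individual
  walks.\<close>

lemma gdist_ge_of_lipschitz:
  fixes h :: "'a \<Rightarrow> nat"
  assumes "wf_digraph G" "\<And>e. e \<in> arcs G \<Longrightarrow> h (head G e) \<le> Suc (h (tail G e))"
  shows "enat (h v - h u) \<le> gdist G u v"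
proof -
  interpret wf_digraph G by fact
  have "h v \<le> h u + length p" if "awalk u p v" for p
    using that
  proof (induction p arbitrary: u)
    case Nil
    then show ?case by (simp add: awalk_Nil_iff)
  next
    case (Cons e p)
    then have "e \<in> arcs G" "tail G e = u" "awalk (head G e) p v"
      by (auto simp: awalk_Cons_iff)
    then show ?case
      using Cons.IH[of "head G e"] assms(2)[of e] by simp
  qed
  then show ?thesis
    unfolding gdist_def by (intro INF_greatest) (simp add: le_diff_conv add.commute)
qed

lemma gdist_le_ecc: "u \<in> verts G \<Longrightarrow> gdist G v u \<le> ecc G v"
  unfolding ecc_def by (rule SUP_upper)

lemma ecc_le_diam: "v \<in> verts G \<Longrightarrow> ecc G v \<le> diam G"
  unfolding diam_def by (rule SUP_upper)

text \<open>The pair \<open>a\<close>, \<open>b\<close> closes the chain d \<le>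
  \<open>gdist G a b\<close> \<le> \<open>ecc G a\<close> \<le> \<open>diam G\<close> \<le>
  d.\<close>

lemma diam_ecc_eqI:
  assumes "\<And>u v. u \<in> verts G \<Longrightarrow> v \<in> verts G \<Longrightarrow> gdist G u v \<le> d"
    and "a \<in> verts G" "b \<in> verts G" "d \<le> gdist G a b"
  shows "diam G = d" "ecc G a = d"
proof -
  have "diam G \<le> d"
    unfolding diam_def ecc_def by (intro SUP_least assms(1))
  moreover have "d \<le> ecc G a"
    using assms(4) gdist_le_ecc[OF assms(3)] by (rule order_trans)
  moreover have "ecc G a \<le> diam G"
    using assms(2) by (rule ecc_le_diam)
  ultimately show "diam G = d" "ecc G a = d"
    by auto
qed

section \<open>Packing broadcasts\<close>

text \<open>A vertex in two balls would hear two broadcasting vertices, so the balls are disjoint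
  and their sizes add up. The weight \<open>g\<close> is left open: it becomes
  \<open>f v + 1\<close> on paths and \<open>2 * f v\<close> on cycles.\<close>

lemma sum_broadcast_le_card_verts:
  assumes "finite (verts G)" "packing_broadcast G f"
    and "\<And>v. v \<in> broadcast_verts G f \<Longrightarrow> g v \<le> card {u \<in> verts G. gdist G u v \<le> enat (f v)}"
  shows "sum g (broadcast_verts G f) \<le> card (verts G)"
proof -
  let ?B = "\<lambda>v. {u \<in> verts G. gdist G u v \<le> enat (f v)}"
  have fin: "finite (broadcast_verts G f)"
    using assms(1) by (simp add: broadcast_verts_def)
  have "v = w" if "v \<in> broadcast_verts G f" "w \<in> broadcast_verts G f" "u \<in> ?B v" "u \<in> ?B w" for u v w
  proof -
    have "card (heard G f u) \<le> 1"
      using assms(2) that(3) by (simp add: packing_broadcast_def)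
    \<comment> \<open>Without finiteness the bound on \<open>card\<close> would say nothing, since
      infinite sets have cardinality 0.\<close>
    moreover have "finite (heard G f u)"
      using fin by (simp add: heard_def)
    moreover have "v \<in> heard G f u" "w \<in> heard G f u"
      using that by (auto simp: heard_def)
    ultimately show ?thesis
      by (auto simp: card_le_Suc0_iff_eq)
  qed
  then have disj: "\<forall>v\<in>broadcast_verts G f. \<forall>w\<in>broadcast_verts G f. v \<noteq> w \<longrightarrow> ?B v \<inter> ?B w = {}"
    by blast
  have "sum g (broadcast_verts G f) \<le> (\<Sum>v\<in>broadcast_verts G f. card (?B v))"
    by (intro sum_mono assms(3))
  also have "\<dots> = card (\<Union>v\<in>broadcast_verts G f. ?B v)"
    using fin assms(1) disj by (intro card_UN_disjoint[symmetric]) auto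
  also have "\<dots> \<le> card (verts G)"
    using assms(1) by (intro card_mono) auto
  finally show ?thesis .
qed

lemma cost_eq_sum_broadcast_verts:
  "finite (verts G) \<Longrightarrow> cost G f = sum f (broadcast_verts G f)"
  unfolding cost_def broadcast_verts_def by (intro sum.mono_neutral_right) auto

lemma packing_broadcast_number_eqI:
  assumes "finite (verts G)" "a \<in> verts G" "diam G = enat d" "ecc G a = enat d"
    and "\<And>f. packing_broadcast G f \<Longrightarrow> cost G f \<le> d"
  shows "packing_broadcast_number G = d"
  unfolding packing_broadcast_number_def
proof (rule Max_eqI)
  \<comment> \<open>Values off \<open>verts G\<close> are arbitrary, so there may be infinitely many
    broadcasts; their costs are nevertheless bounded by \<open>d\<close>.\<close>
  show "finite {cost G f |f. packing_broadcast G f}"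
    by (rule finite_subset[of _ "{..d}"]) (use assms(5) in auto)
  show "c \<le> d" if "c \<in> {cost G f |f. packing_broadcast G f}" for c
    using that assms(5) by auto
  \<comment> \<open>A single broadcasting vertex cannot conflict with another, and
    \<open>ecc G a = d\<close> permits the full strength \<open>d\<close>.\<close>
  let ?f = "\<lambda>v. if v = a then d else 0"
  have "heard G ?f u \<subseteq> {a}" for u
    by (auto simp: heard_def broadcast_verts_def split: if_splits)
  then have "card (heard G ?f u) \<le> 1" for u
    using card_mono[of "{a}" "heard G ?f u"] by simp
  then have "packing_broadcast G ?f"
    using assms(2-4) by (auto simp: packing_broadcast_def broadcast_def zero_enat_def[symmetric])
  moreover have "cost G ?f = d"
    using assms(1,2) by (simp add: cost_def)
  ultimately show "d \<in> {cost G f |f. packing_broadcast G f}"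
    by force
qed

section \<open>Paths\<close>

lemma pverts_path_graph [simp]: "pverts (path_graph n) = {0..<n}"
  by (simp add: path_graph_def)

lemma wf_digraph_path_graph: "wf_digraph (path_graph n)"
proof -
  interpret pair_graph "path_graph n" by (rule pair_graph_path_graph)
  show ?thesis by unfold_locales
qed

lemma parcs_path_graph:
  "parcs (path_graph n) = {(i, j). i < n \<and> j < n \<and> (j = Suc i \<or> i = Suc j)}"
  by (simp add: path_graph_def)

lemma gdist_path_graph_le:
  assumes "u \<le> v" "v < n"
  shows "gdist (path_graph n) u v \<le> enat (v - u)" "gdist (path_graph n) v u \<le> enat (v - u)"
proof -
  have "(u + i, u + Suc i) \<in> arcs_ends (path_graph n)"
    "(v - i, v - Suc i) \<in> arcs_ends (path_graph n)" if "i < v - u" for i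
    using that assms by (auto simp: parcs_path_graph)
  then show "gdist (path_graph n) u v \<le> enat (v - u)" "gdist (path_graph n) v u \<le> enat (v - u)"
    using gdist_le_of_chain[OF wf_digraph_path_graph, of "\<lambda>i. u + i" n "v - u"]
      gdist_le_of_chain[OF wf_digraph_path_graph, of "\<lambda>i. v - i" n "v - u"] assms
    by simp_all
qed

lemma gdist_path_graph_ge: "enat (v - u) \<le> gdist (path_graph n) u v"
proof -
  have "id (head (path_graph n) e) \<le> Suc (id (tail (path_graph n) e))" if "e \<in> arcs (path_graph n)" for e
    using that by (cases e) (auto simp: parcs_path_graph)
  from gdist_ge_of_lipschitz[OF wf_digraph_path_graph this] show ?thesis
    by simp
qed

text \<open>The farthest vertex is an end of the path: the ends lie \<open>v\<close> and
  \<open>n - 1 - v\<close> steps away.\<close>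

lemma ecc_path_graph_le:
  assumes "v < n"
  shows "ecc (path_graph n) v \<le> enat (max v (n - 1 - v))"
  unfolding ecc_def
proof (rule SUP_least)
  fix u assume "u \<in> verts (path_graph n)"
  then have "u < n" by simp
  show "gdist (path_graph n) v u \<le> enat (max v (n - 1 - v))"
  proof (cases "u \<le> v")
    case True
    show ?thesis
      by (rule order_trans[OF gdist_path_graph_le(2)]) (use True assms in auto)
  next
    case False
    show ?thesis
      by (rule order_trans[OF gdist_path_graph_le(1)]) (use False \<open>u < n\<close> in auto)
  qed
qed

text \<open>At least one end of the path is \<open>r\<close> or more steps away from
  \<open>v\<close>. The segment of \<open>r + 1\<close> vertices from \<open>v\<close> towards that
  end lies in the ball.\<close>

lemma card_ball_path_graph_ge:
  assumes "v < n" "r \<le> max v (n - 1 - v)"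
  shows "r + 1 \<le> card {u \<in> verts (path_graph n). gdist (path_graph n) u v \<le> enat r}"
proof -
  let ?B = "{u \<in> verts (path_graph n). gdist (path_graph n) u v \<le> enat r}"
  have "\<exists>A. A \<subseteq> ?B \<and> card A = r + 1"
  proof (cases "r \<le> v")
    case True
    have "gdist (path_graph n) u v \<le> enat r" if "u \<in> {v - r..v}" for u
      by (rule order_trans[OF gdist_path_graph_le(1)]) (use that assms True in auto)
    then show ?thesis
      using True assms by (intro exI[of _ "{v - r..v}"]) auto
  next
    case False
    have "gdist (path_graph n) u v \<le> enat r" if "u \<in> {v..v + r}" for u
      by (rule order_trans[OF gdist_path_graph_le(2)]) (use that assms False in auto)
    then show ?thesis
      using False assms by (intro exI[of _ "{v..v + r}"]) auto
  qed
  then obtain A where "A \<subseteq> ?B" "card A = r + 1"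
    by blast
  then show ?thesis
    using card_mono[of ?B A] by simp
qed

lemma diam_ecc_path_graph:
  assumes "n \<ge> 1"
  shows "diam (path_graph n) = enat (n - 1)" "ecc (path_graph n) 0 = enat (n - 1)"
proof -
  have "gdist (path_graph n) u v \<le> enat (n - 1)" if "u < n" "v < n" for u v
    by (rule order_trans[OF gdist_le_ecc order_trans[OF ecc_path_graph_le]]) (use that in auto)
  then show "diam (path_graph n) = enat (n - 1)" "ecc (path_graph n) 0 = enat (n - 1)"
    using diam_ecc_eqI[of "path_graph n" "enat (n - 1)" 0 "n - 1"]
      gdist_path_graph_ge[of "n - 1" 0 n] assms by auto
qed

lemma cost_path_graph_le:
  assumes "packing_broadcast (path_graph n) f"
  shows "cost (path_graph n) f \<le> n - 1"
\<comment> \<open>Each ball has one vertex to spare beyond \<open>f v\<close>. A single broadcasting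
  vertex thus improves the bound from \<open>n\<close> to \<open>n - 1\<close>; with none the cost
  is 0.\<close>
proof (cases "broadcast_verts (path_graph n) f = {}")
  case True
  then show ?thesis by (simp add: cost_eq_sum_broadcast_verts)
next
  case False
  let ?V = "broadcast_verts (path_graph n) f"
  have "f v + 1 \<le> card {u \<in> verts (path_graph n). gdist (path_graph n) u v \<le> enat (f v)}"
    if "v \<in> ?V" for v
  proof (rule card_ball_path_graph_ge)
    show "v < n"
      using that by (simp add: broadcast_verts_def)
    then have "enat (f v) \<le> ecc (path_graph n) v"
      using assms by (simp add: packing_broadcast_def broadcast_def)
    also have "\<dots> \<le> enat (max v (n - 1 - v))"
      using \<open>v < n\<close> by (rule ecc_path_graph_le)
    finally show "f v \<le> max v (n - 1 - v)"
      by simp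
  qed
  then have "(\<Sum>v\<in>?V. f v + 1) \<le> card (verts (path_graph n))"
    using assms by (intro sum_broadcast_le_card_verts) auto
  then have "cost (path_graph n) f + card ?V \<le> n"
    by (simp add: cost_eq_sum_broadcast_verts sum.distrib sum_Suc)
  moreover have "card ?V > 0"
    using False by (simp add: card_gt_0_iff broadcast_verts_def)
  ultimately show ?thesis by linarith
qed

section \<open>Cycles\<close>

lemma pverts_cycle_graph [simp]: "pverts (cycle_graph n) = {0..<n}"
  by (simp add: cycle_graph_def)

lemma wf_digraph_cycle_graph: "n \<ge> 2 \<Longrightarrow> wf_digraph (cycle_graph n)"
proof -
  assume "n \<ge> 2"
  then interpret pair_graph "cycle_graph n" by (rule pair_graph_cycle_graph)
  show ?thesis by unfold_locales
qed

lemma parcs_cycle_graph: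
  "parcs (cycle_graph n) = {(i, j). i < n \<and> j < n \<and> (j = Suc i mod n \<or> i = Suc j mod n)}"
  by (simp add: cycle_graph_def)

lemma gdist_cycle_graph_le:
  assumes "n \<ge> 2" "u < n"
  shows "gdist (cycle_graph n) u ((u + k) mod n) \<le> enat k"
    and "gdist (cycle_graph n) ((u + k) mod n) u \<le> enat k"
proof -
  show "gdist (cycle_graph n) u ((u + k) mod n) \<le> enat k"
    using gdist_le_of_chain[OF wf_digraph_cycle_graph, of n "\<lambda>i. (u + i) mod n" k] assms
    by (simp add: parcs_cycle_graph mod_Suc_eq)
  \<comment> \<open>The return walk counts the offset down from \<open>k\<close>, so each of its
    arcs is a forward arc reversed.\<close>
  have "Suc ((u + (k - Suc i)) mod n) mod n = (u + (k - i)) mod n" if "i < k" for i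
    using that by (simp add: mod_Suc_eq Suc_diff_Suc flip: add_Suc_right)
  then show "gdist (cycle_graph n) ((u + k) mod n) u \<le> enat k"
    using gdist_le_of_chain[OF wf_digraph_cycle_graph, of n "\<lambda>i. (u + (k - i)) mod n" k] assms
    by (simp add: parcs_cycle_graph)
qed

text \<open>Another \<open>n - k\<close> forward steps from the vertex at offset \<open>k\<close>
  complete the turn back to \<open>u\<close>.\<close>

lemma gdist_cycle_graph_le_compl:
  assumes "n \<ge> 2" "u < n" "k \<le> n"
  shows "gdist (cycle_graph n) u ((u + k) mod n) \<le> enat (n - k)"
    and "gdist (cycle_graph n) ((u + k) mod n) u \<le> enat (n - k)"
proof -
  have "((u + k) mod n + (n - k)) mod n = u"
    using assms by (subst mod_add_left_eq) simp
  then show "gdist (cycle_graph n) u ((u + k) mod n) \<le> enat (n - k)"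
    "gdist (cycle_graph n) ((u + k) mod n) u \<le> enat (n - k)"
    using gdist_cycle_graph_le[of n "(u + k) mod n" "n - k"] assms by auto
qed

text \<open>The potential is the length of the shorter way round to 0. It changes by at most one
  along every arc, including those between \<open>n - 1\<close> and 0.\<close>

lemma gdist_cycle_graph_ge:
  assumes "n \<ge> 2"
  shows "enat (min v (n - v)) \<le> gdist (cycle_graph n) 0 v"
proof -
  have "min j (n - j) \<le> Suc (min i (n - i))"
    if "i < n" "j < n" "j = Suc i mod n \<or> i = Suc j mod n" for i j
  proof -
    have "Suc i mod n = (if Suc i = n then 0 else Suc i)" "Suc j mod n = (if Suc j = n then 0 else Suc j)"
      using that by auto
    then show ?thesis
      using that(3) by (cases "Suc i = n"; cases "Suc j = n") auto
  qed
  then show ?thesis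
    using gdist_ge_of_lipschitz[OF wf_digraph_cycle_graph[OF assms], of "\<lambda>i. min i (n - i)" v 0]
    by (force simp: parcs_cycle_graph)
qed

lemma diam_ecc_cycle_graph:
  assumes "n \<ge> 2"
  shows "diam (cycle_graph n) = enat (n div 2)" "ecc (cycle_graph n) 0 = enat (n div 2)"
proof -
  have "gdist (cycle_graph n) u v \<le> enat (n div 2)" if "u < n" "v < n" for u v
  proof -
    \<comment> \<open>This is the number of forward steps from \<open>u\<close> to \<open>v\<close>;
      adding \<open>n - u\<close> avoids truncated subtraction. One of \<open>k\<close> and
      \<open>n - k\<close> is at most \<open>n div 2\<close>.\<close>
    define k where "k = (v + (n - u)) mod n"
    have k: "k < n" "(u + k) mod n = v"
      using that assms by (auto simp: k_def mod_add_right_eq)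
    show ?thesis
    proof (cases "k \<le> n div 2")
      case True
      then show ?thesis
        using order_trans[OF gdist_cycle_graph_le(1)[of n u k], of "enat (n div 2)"] k that assms by simp
    next
      case False
      then have "n - k \<le> n div 2" by linarith
      then show ?thesis
        using order_trans[OF gdist_cycle_graph_le_compl(1)[of n u k], of "enat (n div 2)"] k that assms by simp
    qed
  qed
  moreover have "min (n div 2) (n - n div 2) = n div 2"
    by linarith
  then have "enat (n div 2) \<le> gdist (cycle_graph n) 0 (n div 2)"
    using gdist_cycle_graph_ge[of n "n div 2"] assms by simp
  ultimately show "diam (cycle_graph n) = enat (n div 2)" "ecc (cycle_graph n) 0 = enat (n div 2)"
    using diam_ecc_eqI[of "cycle_graph n" "enat (n div 2)" 0 "n div 2"] assms by auto
qed

lemma card_ball_cycle_graph_ge: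
  assumes "n \<ge> 2" "v < n" "r \<le> n div 2"
  shows "2 * r \<le> card {u \<in> verts (cycle_graph n). gdist (cycle_graph n) u v \<le> enat r}"
proof -
  let ?B = "{u \<in> verts (cycle_graph n). gdist (cycle_graph n) u v \<le> enat r}"
  \<comment> \<open>These offsets are \<open>v\<close> itself with \<open>r - 1\<close> steps
    forward, and \<open>r\<close> steps backward (for \<open>r > 0\<close>). Forward offset
    \<open>r\<close> is left out because it meets backward offset \<open>r\<close> when
    \<open>2 * r = n\<close>.\<close>
  let ?K = "{0..<r} \<union> {n - r..<n}"
  have inj: "inj_on (\<lambda>k. (v + k) mod n) ?K"
  proof (rule inj_on_subset)
    have "(v + k) mod n = (if v + k < n then v + k else v + k - n)" if "k < n" for k
      using that assms(2) by (simp add: mod_if)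
    then show "inj_on (\<lambda>k. (v + k) mod n) {0..<n}"
      using assms(2) by (intro inj_onI) (force split: if_splits)
    show "?K \<subseteq> {0..<n}"
      using assms by auto
  qed
  have "card ?K = 2 * r"
    using assms by (subst card_Un_disjoint) auto
  then have "2 * r = card ((\<lambda>k. (v + k) mod n) ` ?K)"
    using inj by (simp add: card_image)
  also have "\<dots> \<le> card ?B"
  proof (rule card_mono)
    have "gdist (cycle_graph n) ((v + k) mod n) v \<le> enat r" if "k \<in> ?K" for k
    proof (cases "k < r")
      case True
      show ?thesis
        by (rule order_trans[OF gdist_cycle_graph_le(2)]) (use True assms in auto)
    next
      case False
      show ?thesis
        by (rule order_trans[OF gdist_cycle_graph_le_compl(2)]) (use False assms that in auto)
    qed
    then show "(\<lambda>k. (v + k) mod n) ` ?K \<subseteq> ?B"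
      using assms by auto
  qed simp
  finally show ?thesis .
qed

lemma cost_cycle_graph_le:
  assumes "n \<ge> 2" "packing_broadcast (cycle_graph n) f"
  shows "cost (cycle_graph n) f \<le> n div 2"
proof -
  let ?V = "broadcast_verts (cycle_graph n) f"
  have "2 * f v \<le> card {u \<in> verts (cycle_graph n). gdist (cycle_graph n) u v \<le> enat (f v)}"
    if "v \<in> ?V" for v
    using that assms by (intro card_ball_cycle_graph_ge)
      (auto simp: broadcast_verts_def packing_broadcast_def broadcast_def diam_ecc_cycle_graph)
  \<comment> \<open>This says that twice the cost is at most \<open>n\<close>; integrality of the
    cost then gives the floor.\<close>
  then have "(\<Sum>v\<in>?V. 2 * f v) \<le> card (verts (cycle_graph n))"
    using assms by (intro sum_broadcast_le_card_verts) auto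
  then show ?thesis
    by (simp add: cost_eq_sum_broadcast_verts sum_distrib_left[symmetric])
qed

theorem theorem3p14:
  shows "(\<forall>n::nat. n \<ge> 2 \<longrightarrow>
            enat (packing_broadcast_number (path_graph n)) = diam (path_graph n) \<and>
            diam (path_graph n) = enat (n - 1)) \<and>
         (\<forall>n::nat. n \<ge> 3 \<longrightarrow>
            enat (packing_broadcast_number (cycle_graph n)) = diam (cycle_graph n) \<and>
            diam (cycle_graph n) = enat (n div 2))"
proof (intro conjI allI impI)
  fix n :: nat
  assume n: "n \<ge> 2"
  show d: "diam (path_graph n) = enat (n - 1)"
    using n by (intro diam_ecc_path_graph) simp
  have "packing_broadcast_number (path_graph n) = n - 1"
    using n by (intro packing_broadcast_number_eqI[of _ 0] diam_ecc_path_graph cost_path_graph_le) auto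
  then show "enat (packing_broadcast_number (path_graph n)) = diam (path_graph n)"
    using d by simp
next
  fix n :: nat
  assume n: "n \<ge> 3"
  show d: "diam (cycle_graph n) = enat (n div 2)"
    using n by (intro diam_ecc_cycle_graph) simp
  have "packing_broadcast_number (cycle_graph n) = n div 2"
    using n by (intro packing_broadcast_number_eqI[of _ 0] diam_ecc_cycle_graph cost_cycle_graph_le) auto
  then show "enat (packing_broadcast_number (cycle_graph n)) = diam (cycle_graph n)"
    using d by simp
qed

end
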